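(* Let $f(x) = 1 - \left(x + \frac{i}{2}\right)^2$, where $i$ is the imaginary unit. For positive integers $p$ let $M_p = \int_{-1}^1 f(x)^p\,dx \in \mathbb{C}$, and let $L(f) = \limsup_{p\to\infty} |M_p|^{1/p}$. Then $\sup_{x \in [-1,1]} |f(x)| = |f(0)| = \frac{5}{4}$, but $L(f) \leq \frac{\sqrt{17}}{4}$.
   Context: Here the moments $M_p$ are integrals of complex-valued functions over the real interval $[-1,1]$ (not $[0,1]$), and $L(f)$ is defined using these moments. *)

theory Defs
  imports "HOL-Analysis.Analysis"
begin

definition moment :: "(real \<Rightarrow> complex) \<Rightarrow> nat \<Rightarrow> complex" where
  "moment f p = integral {-1..1} (\<lambda>x. f x ^ p)"

(* The limsup is taken in the extended reals, so no boundedness assumption on the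
   sequence is needed. The junk value at p = 0 (root 0 _ = 0) does not affect it. *)
definition moment_growth :: "(real \<Rightarrow> complex) \<Rightarrow> ereal" where
  "moment_growth f = limsup (\<lambda>p. ereal (root p (cmod (moment f p))))"

end

theory Submission
  imports Defs "HOL-Complex_Analysis.Cauchy_Integral_Theorem"
begin

text \<open>
  Put \<open>g z = 1 - z\<^sup>2\<close>, so that \<open>f x = g (x + \<i> / 2)\<close> and \<open>M\<^sub>p\<close> is the integral of the entire
  function \<open>g ^ p\<close> along the horizontal segment from \<open>-1 + \<i> / 2\<close> to \<open>1 + \<i> / 2\<close>. On that
  segment \<open>\<bar>g\<bar>\<close> reaches \<open>5 / 4\<close>, but the integral depends only on the endpoints, so the path
  can be pushed down to the real axis: from \<open>-1 + \<i> / 2\<close> to \<open>-1\<close>, along the reals to \<open>1\<close>,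
  and up to \<open>1 + \<i> / 2\<close>. On the middle piece \<open>\<bar>g\<bar> \<le> 1\<close>; on the vertical pieces
  \<open>\<bar>g (\<plusminus>1 + \<i> t)\<bar>\<^sup>2 = t\<^sup>4 + 4 t\<^sup>2\<close>, which is largest at the endpoints \<open>t = 1 / 2\<close>, where it
  equals \<open>17 / 16\<close>. The new path has length \<open>3\<close>, hence \<open>\<bar>M\<^sub>p\<bar> \<le> 3 (\<surd>17 / 4)\<^sup>p\<close>, and the
  constant \<open>3\<close> disappears on taking \<open>p\<close>-th roots.

  Instead of contour integrals, the argument works with a primitive \<open>G\<close> of \<open>g ^ p\<close>: each piece
  of the path contributes a difference of two values of \<open>G\<close>, which the mean value inequality
  bounds.
\<close>

text \<open>
  The constant is harmless because \<open>root p C\<close> tends to \<open>1\<close>.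
\<close>

lemma limsup_root_le_of_geometric_bound:
  fixes a :: "nat \<Rightarrow> real"
  assumes bound: "\<And>p. a p \<le> C * r ^ p" and "C > 0" "r \<ge> 0"
  shows "limsup (\<lambda>p. ereal (root p (a p))) \<le> ereal r"
proof -
  have "\<forall>\<^sub>F p in sequentially. ereal (root p (a p)) \<le> ereal (root p C * r)"
    using eventually_gt_at_top[of 0]
  proof eventually_elim
    case (elim p)
    have "root p (a p) \<le> root p (C * r ^ p)"
      using elim bound by (intro real_root_le_mono) auto
    also have "\<dots> = root p C * r"
      using elim \<open>r \<ge> 0\<close> by (simp add: real_root_mult real_root_power_cancel)
    finally show ?case by simp
  qed
  then have "limsup (\<lambda>p. ereal (root p (a p))) \<le> limsup (\<lambda>p. ereal (root p C * r))"
    by (rule Limsup_mono)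
  also have "(\<lambda>p. root p C * r) \<longlonglongrightarrow> 1 * r"
    using \<open>C > 0\<close> by (intro tendsto_mult LIMSEQ_root_const tendsto_const)
  then have "limsup (\<lambda>p. ereal (root p C * r)) = ereal r"
    by (intro lim_imp_Limsup) (auto intro: tendsto_ereal)
  finally show ?thesis .
qed

lemma integral_horizontal_segment:
  fixes G g :: "complex \<Rightarrow> complex" and a b :: real
  assumes "\<And>z. (G has_field_derivative g z) (at z)" and "a \<le> b"
  shows "integral {a..b} (\<lambda>x. g (of_real x + w)) = G (of_real b + w) - G (of_real a + w)"
proof (rule integral_unique, rule fundamental_theorem_of_calculus[OF \<open>a \<le> b\<close>])
  fix x
  have "((\<lambda>x. of_real x + w) has_vector_derivative 1) (at x within {a..b})"
    by (auto intro!: derivative_eq_intros)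
  from field_vector_diff_chain_within[OF this] assms(1)
  show "((\<lambda>x. G (of_real x + w)) has_vector_derivative g (of_real x + w)) (at x within {a..b})"
    by (force simp: o_def intro: has_field_derivative_at_within)
qed

lemma primitive_increment_bound:
  fixes G g :: "complex \<Rightarrow> complex"
  assumes "\<And>z. (G has_field_derivative g z) (at z)"
    and "\<And>z. z \<in> closed_segment u v \<Longrightarrow> cmod (g z) \<le> B"
  shows "cmod (G u - G v) \<le> B * cmod (u - v)"
  by (rule field_differentiable_bound[of "closed_segment u v" G g])
     (auto intro: assms has_field_derivative_at_within)

lemma power_bound_of_square:
  assumes "cmod z ^ 2 \<le> 17 / 16"
  shows "cmod (z ^ p) \<le> (sqrt 17 / 4) ^ p"
proof -
  have "cmod z \<le> sqrt (17 / 16)"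
    using assms by (rule real_le_rsqrt)
  also have "sqrt (17 / 16) = sqrt 17 / 4"
    by (simp add: real_sqrt_divide)
  finally show ?thesis
    by (simp add: norm_power power_mono)
qed

text \<open>
  With \<open>z = s + \<i> t\<close> and \<open>s = \<plusminus>1\<close>, the real part of \<open>1 - z\<^sup>2\<close> shrinks to \<open>t\<^sup>2\<close>, and the modulus
  grows with \<open>t\<close>; the top corner, an endpoint of the original segment, is the worst point.
\<close>

lemma vertical_side_bound:
  assumes "s\<^sup>2 = 1" and "z \<in> closed_segment (Complex s (1 / 2)) (Complex s 0)"
  shows "cmod (1 - z\<^sup>2) ^ 2 \<le> 17 / 16"
proof -
  from assms(2) obtain u where u: "0 \<le> u" "u \<le> 1"
    and z: "z = (1 - u) *\<^sub>R Complex s (1 / 2) + u *\<^sub>R Complex s 0"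
    by (auto simp: closed_segment_def)
  define t where "t = (1 - u) / 2"
  have t: "0 \<le> t" "t \<le> 1 / 2"
    using u by (auto simp: t_def)
  have "z = Complex s t"
    by (simp add: z t_def complex_eq_iff algebra_simps)
  then have "cmod (1 - z\<^sup>2) ^ 2 = (1 - s\<^sup>2 + t\<^sup>2)\<^sup>2 + 4 * s\<^sup>2 * t\<^sup>2"
    unfolding cmod_power2 by (simp add: power2_eq_square algebra_simps)
  also have "\<dots> = (t\<^sup>2)\<^sup>2 + 4 * t\<^sup>2"
    using assms(1) by simp
  also have "\<dots> \<le> ((1 / 2)\<^sup>2)\<^sup>2 + 4 * (1 / 2)\<^sup>2"
    using t by (intro add_mono mult_left_mono power_mono) auto
  finally show ?thesis
    by (simp add: power2_eq_square)
qed

lemma real_side_bound: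
  assumes "z \<in> closed_segment (-1) (1 :: complex)"
  shows "cmod (1 - z\<^sup>2) ^ 2 \<le> 17 / 16"
proof -
  have "z \<in> closed_segment (of_real (-1)) (of_real 1)"
    using assms by simp
  then obtain x :: real where z: "z = of_real x" and x: "-1 \<le> x" "x \<le> 1"
    unfolding closed_segment_of_real closed_segment_eq_real_ivl by auto
  have "x\<^sup>2 \<le> 1"
    using x by (simp add: abs_square_le_1 abs_le_iff)
  moreover have "cmod (1 - z\<^sup>2) = \<bar>1 - x\<^sup>2\<bar>"
    unfolding z by (metis norm_of_real of_real_1 of_real_diff of_real_power)
  ultimately have "cmod (1 - z\<^sup>2) ^ 2 \<le> 1"
    by (simp add: abs_square_le_1)
  then show ?thesis by simp
qed

text \<open>
  The height \<open>1 / 2\<close> of the segment makes the detour have total length \<open>1 / 2 + 2 + 1 / 2 = 3\<close>.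
  On the middle side the bound \<open>17 / 16\<close> for \<open>\<bar>1 - z\<^sup>2\<bar>\<^sup>2\<close> could be replaced by \<open>1\<close>, but the
  vertical sides determine the growth rate, so one bound is used throughout.
\<close>

lemma shifted_moment_bound:
  "cmod (integral {-1..1} (\<lambda>x. (1 - (complex_of_real x + \<i> / 2)\<^sup>2) ^ p)) \<le> 3 * (sqrt 17 / 4) ^ p"
proof -
  define g :: "complex \<Rightarrow> complex" where "g z = (1 - z\<^sup>2) ^ p" for z
  define B where "B = (sqrt 17 / 4) ^ p"
  have "g holomorphic_on UNIV"
    unfolding g_def by (intro holomorphic_intros)
  then obtain G where G: "\<And>z. (G has_field_derivative g z) (at z)"
    using holomorphic_convex_primitive'[of UNIV g] by auto
  have side: "cmod (G (Complex s (1 / 2)) - G (Complex s 0)) \<le> B / 2" if "s\<^sup>2 = 1" for s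
  proof -
    have "cmod (G (Complex s (1 / 2)) - G (Complex s 0))
        \<le> B * cmod (Complex s (1 / 2) - Complex s 0)"
      unfolding B_def
      by (rule primitive_increment_bound[OF G])
         (auto simp: g_def intro!: power_bound_of_square vertical_side_bound[OF that])
    also have "cmod (Complex s (1 / 2) - Complex s 0) = 1 / 2"
      by (simp add: cmod_def)
    finally show ?thesis by simp
  qed
  have real_axis: "cmod (G (-1) - G 1) \<le> B * 2"
    using primitive_increment_bound[OF G, of "-1" 1 B]
    by (auto simp: g_def B_def intro!: power_bound_of_square real_side_bound)
  have corners: "of_real 1 + \<i> / 2 = Complex 1 (1 / 2)" "of_real (-1) + \<i> / 2 = Complex (-1) (1 / 2)"
    "1 = Complex 1 0" "-1 = Complex (-1) 0"
    by (simp_all add: complex_eq_iff)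
  \<comment> \<open>Telescoping along the detour, with the corners \<open>-1\<close> and \<open>1\<close> inserted.\<close>
  have "integral {-1..1} (\<lambda>x. g (of_real x + \<i> / 2)) = G (of_real 1 + \<i> / 2) - G (of_real (-1) + \<i> / 2)"
    by (rule integral_horizontal_segment[OF G]) simp
  also have "\<dots> = (G (Complex 1 (1 / 2)) - G (Complex 1 0))
      - (G (Complex (-1) (1 / 2)) - G (Complex (-1) 0)) - (G (-1) - G 1)"
    unfolding corners(1,2) by (simp flip: corners(3,4))
  also have "cmod \<dots> \<le> B / 2 + B / 2 + B * 2"
    by (intro order_trans[OF norm_triangle_ineq4] add_mono side real_axis) auto
  finally show ?thesis
    by (simp add: g_def B_def)
qed

theorem proposition3:
  fixes f :: "real \<Rightarrow> complex"
  assumes "\<And>x. f x = 1 - (complex_of_real x + \<i> / 2)^2"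
  shows "(SUP x\<in>{-1..1}. cmod (f x)) = cmod (f 0)
    \<and> cmod (f 0) = 5 / 4
    \<and> moment_growth f \<le> ereal (sqrt 17 / 4)"
proof (intro conjI)
  have f0: "f 0 = of_real (5 / 4)"
    by (simp add: assms power2_eq_square)
  show norm_f0: "cmod (f 0) = 5 / 4"
    unfolding f0 by (subst norm_of_real) simp
  have "cmod (f x) \<le> cmod (f 0)" if "x \<in> {-1..1}" for x
  proof (rule power2_le_imp_le)
    have "x\<^sup>2 \<le> 1"
      using that by (simp add: abs_square_le_1 abs_le_iff)
    have "cmod (f x) ^ 2 = (5 / 4)\<^sup>2 - x\<^sup>2 * (3 / 2 - x\<^sup>2)"
      unfolding assms cmod_power2 by (simp add: power2_eq_square field_simps)
    also have "\<dots> \<le> (5 / 4)\<^sup>2"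
      using \<open>x\<^sup>2 \<le> 1\<close> by simp
    finally show "cmod (f x) ^ 2 \<le> cmod (f 0) ^ 2"
      by (simp add: norm_f0)
  qed simp
  then show "(SUP x\<in>{-1..1}. cmod (f x)) = cmod (f 0)"
    by (intro cSup_eq_maximum) auto
  show "moment_growth f \<le> ereal (sqrt 17 / 4)"
    unfolding moment_growth_def
    by (rule limsup_root_le_of_geometric_bound[where C = 3])
       (use shifted_moment_bound in \<open>simp_all add: moment_def assms\<close>)
qed

end
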